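(* Let $D=(V,A)$ be a digraph, $E,T\subseteq V$, let $c$ be a cycle in $D$, let $x,t\notin V$ be distinct new elements, and let $D'=D^{(c)}_{(x,t)}$ be the lifting of $c$ in $D$ by $(x,t)$. Then $$\Gamma(D,T,E)=\Gamma\bigl(D',\,T\cup\{t\},\,E\cup\{x\}\bigr).E,$$ where $N.E$ denotes the contraction of the matroid $N$ to $E$.
   Context: A digraph is a pair $D=(V,A)$ with $V$ finite and $A\subseteq V\times V$ (loops allowed). A walk is a non-empty sequence $w_1w_2\ldots w_n$ of vertices with $(w_i,w_{i+1})\in A$ for $1\le i<n$; a path is a walk without repeated vertices (a single vertex is a path). A cycle is a walk $c=c_1c_2\ldots c_n$ with $n>1$, $c_1=c_n$ and $c_1\ldots c_{n-1}$ a path (so loops are cycles). For $X,Y\subseteq V$, a routing from $X$ to $Y$ in $D$ is a family $R$ of pairwise vertex-disjoint paths of $D$ such that every $p\in R$ starts in $X$, every $x\in X$ is the first vertex of some $p\in R$, and every $p\in R$ ends in $Y$. For $T,E\subseteq V$, the gammoid $\Gamma(D,T,E)$ is the matroid on $E$ whose independent sets are those $X\subseteq E$ for which there is a routing from $X$ to $T$ in $D$. For a matroid $N$ on ground set $E_N$ and $X\subseteq E_N$, the contraction of $N$ to $X$, written $N.X$, is the matroid on $X$ obtained by contracting $E_N\setminus X$, i.e. $N.X=N/(E_N\setminus X)$. Lifting. Let $c=c_1c_2\ldots c_n$ be a cycle in $D=(V,A)$ and $x,t\notin V$ distinct. The lifting of $c$ in $D$ by $(x,t)$ is the digraph $D^{(c)}_{(x,t)}=(V\cup\{x,t\},A')$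 with $$A'=\bigl(A\setminus\{(c_1,c_2)\}\bigr)\cup\{(c_1,t),(x,c_2),(x,t)\}.$$ *)

theory Defs
  imports "Graph_Theory.Pair_Digraph" "Graph_Theory.Vertex_Walk"
begin

text \<open>
  A digraph $(V,A)$ with $V$ finite and $A \subseteq V \times V$ is a \<^typ>\<open>'a pair_pre_digraph\<close>
  satisfying \<^const>\<open>pair_fin_digraph\<close>. Walks and paths are the non-empty vertex lists
  \<^const>\<open>vwalk\<close> and \<^const>\<open>vpath\<close>.
\<close>

text \<open>The library's \<open>pre_digraph.cycle\<close> is about lists of arcs; here cycles are vertex lists
  with the first vertex repeated at the end, so a loop at \<open>v\<close> is the cycle \<open>[v, v]\<close>.\<close>

definition vcycle :: "'a list \<Rightarrow> 'a pair_pre_digraph \<Rightarrow> bool" where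
  "vcycle c D \<longleftrightarrow> vwalk c (with_proj D) \<and> length c > 1 \<and> hd c = last c
     \<and> vpath (butlast c) (with_proj D)"

text \<open>Paths are non-empty, so a family of pairwise disjoint paths is just a set of paths.\<close>

definition routing :: "'a pair_pre_digraph \<Rightarrow> 'a set \<Rightarrow> 'a set \<Rightarrow> 'a list set \<Rightarrow> bool" where
  "routing D X Y R \<longleftrightarrow>
     (\<forall>p\<in>R. vpath p (with_proj D)) \<and>
     (\<forall>p\<in>R. \<forall>q\<in>R. p \<noteq> q \<longrightarrow> set p \<inter> set q = {}) \<and>
     (\<forall>p\<in>R. hd p \<in> X) \<and>
     (\<forall>x\<in>X. \<exists>p\<in>R. hd p = x) \<and>
     (\<forall>p\<in>R. last p \<in> Y)"

text \<open>A matroid is represented by its ground set and its family of independent sets; two matroids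
  are equal iff both components agree. The record itself does not enforce the matroid axioms.\<close>

record 'a matroid_data =
  ground :: "'a set"
  indeps :: "'a set set"

definition basis_of :: "'a matroid_data \<Rightarrow> 'a set \<Rightarrow> 'a set \<Rightarrow> bool" where
  "basis_of N Z B \<longleftrightarrow> B \<in> indeps N \<and> B \<subseteq> Z
     \<and> (\<forall>B'\<in>indeps N. B \<subseteq> B' \<and> B' \<subseteq> Z \<longrightarrow> B' = B)"

text \<open>The contraction \<open>N / Z\<close>. For a matroid \<open>N\<close>, the choice of the basis \<open>B\<close> of \<open>Z\<close> is
  immaterial.\<close>

definition contract :: "'a matroid_data \<Rightarrow> 'a set \<Rightarrow> 'a matroid_data" where
  "contract N Z =
     \<lparr>ground = ground N - Z,
      indeps = {X. X \<subseteq> ground N - Z \<and> (\<exists>B. basis_of N (ground N \<inter> Z) B \<and> X \<union> B \<in> indeps N)}\<rparr>"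

text \<open>The contraction \<open>N.X\<close> of \<open>N\<close> \<^emph>\<open>to\<close> \<open>X\<close>.\<close>

definition contract_to :: "'a matroid_data \<Rightarrow> 'a set \<Rightarrow> 'a matroid_data" where
  "contract_to N X = contract N (ground N - X)"

definition gammoid :: "'a pair_pre_digraph \<Rightarrow> 'a set \<Rightarrow> 'a set \<Rightarrow> 'a matroid_data" where
  "gammoid D T E = \<lparr>ground = E, indeps = {X. X \<subseteq> E \<and> (\<exists>R. routing D X T R)}\<rparr>"

text \<open>List indices start at 0, so the arc $(c_1,c_2)$ is \<open>(c ! 0, c ! 1)\<close>.\<close>

definition lifting :: "'a pair_pre_digraph \<Rightarrow> 'a list \<Rightarrow> 'a \<Rightarrow> 'a \<Rightarrow> 'a pair_pre_digraph" where
  "lifting D c x t =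
     \<lparr>pverts = pverts D \<union> {x, t},
      parcs = (parcs D - {(c ! 0, c ! 1)}) \<union> {(c ! 0, t), (x, c ! 1), (x, t)}\<rparr>"

end

theory Submission
  imports Defs
begin

text \<open>
  Contracting to \<open>E\<close> means contracting the single element \<open>x\<close>. Since \<open>x \<rightarrow> t\<close> is an arc of the
  lifting, \<open>{x}\<close> is independent, hence it is the only basis of itself, and the claim becomes: a set
  \<open>X \<subseteq> E\<close> is routed to \<open>T\<close> in \<open>D\<close> iff \<open>X \<union> {x}\<close> is routed to \<open>T \<union> {t}\<close> in the lifting.

  Write \<open>(a, b)\<close> for the first arc of the cycle. The lifting replaces it by the two half arcs
  \<open>a \<rightarrow> t\<close> and \<open>x \<rightarrow> b\<close>, together with the shortcut \<open>x \<rightarrow> t\<close>, and nothing leaves \<open>t\<close>.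
  From \<open>D\<close> to the lifting, at most one path of a routing uses \<open>(a, b)\<close>. If there is one,
  it is cut at that arc and the halves are completed by \<open>a \<rightarrow> t\<close> and \<open>x \<rightarrow> b\<close>; if there is none,
  the path \<open>x \<rightarrow> t\<close> is added. In the other direction, let \<open>P\<close> be the path that starts in \<open>x\<close>. If
  some other path ends in \<open>t\<close>, then it got there through \<open>a\<close>, and \<open>P\<close> leaves \<open>x\<close> through \<open>b\<close>, so
  the two are glued along \<open>(a, b)\<close>. Otherwise all paths but \<open>P\<close> end in \<open>T\<close>; they avoid \<open>x\<close>, which
  lies on \<open>P\<close>, and \<open>t\<close>, which could only be their last vertex. So they are paths of \<open>D\<close>, and \<open>P\<close> is
  simply dropped. The lemmas \<open>routing_to_lifted\<close> and \<open>routing_from_lifted\<close> carry out these two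
  transfers.
\<close>

section \<open>Paths, arcs and routings\<close>

lemma vpath_with_proj_iff:
  "vpath p (with_proj G) \<longleftrightarrow>
     p \<noteq> [] \<and> distinct p \<and> set p \<subseteq> pverts G \<and> set (vwalk_arcs p) \<subseteq> parcs G"
  by (auto simp: vpath_def vwalk_def)

lemma in_vwalk_arcs_iff:
  "(u, v) \<in> set (vwalk_arcs p) \<longleftrightarrow> (\<exists>p1 p2. p = p1 @ u # v # p2)"
proof
  assume "(u, v) \<in> set (vwalk_arcs p)"
  then show "\<exists>p1 p2. p = p1 @ u # v # p2"
  proof (induction p rule: vwalk_arcs.induct)
    case (3 y z ys)
    then show ?case
      by (metis append_Cons append_Nil prod.inject set_ConsD vwalk_arcs.simps(3))
  qed auto
next
  assume "\<exists>p1 p2. p = p1 @ u # v # p2"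
  then show "(u, v) \<in> set (vwalk_arcs p)"
    using set_vwalk_arcs_append2 by fastforce
qed

lemma routingI:
  assumes "\<And>p. p \<in> R \<Longrightarrow> vpath p (with_proj D)"
    and "\<And>p q. p \<in> R \<Longrightarrow> q \<in> R \<Longrightarrow> p \<noteq> q \<Longrightarrow> set p \<inter> set q = {}"
    and "hd ` R = X"
    and "\<And>p. p \<in> R \<Longrightarrow> last p \<in> Y"
  shows "routing D X Y R"
  using assms unfolding routing_def by blast

lemma routingD:
  assumes "routing D X Y R"
  shows "p \<in> R \<Longrightarrow> vpath p (with_proj D)"
    and "p \<in> R \<Longrightarrow> q \<in> R \<Longrightarrow> p \<noteq> q \<Longrightarrow> set p \<inter> set q = {}"
    and "hd ` R = X"
    and "p \<in> R \<Longrightarrow> last p \<in> Y"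
proof -
  show "p \<in> R \<Longrightarrow> vpath p (with_proj D)"
    and "p \<in> R \<Longrightarrow> q \<in> R \<Longrightarrow> p \<noteq> q \<Longrightarrow> set p \<inter> set q = {}"
    and "p \<in> R \<Longrightarrow> last p \<in> Y"
    using assms by (simp_all add: routing_def)
  have "hd ` R \<subseteq> X" "\<forall>v\<in>X. \<exists>p\<in>R. hd p = v"
    using assms by (auto simp: routing_def)
  then show "hd ` R = X" by fastforce
qed

section \<open>Lifting an arc\<close>

text \<open>The lifting depends on the cycle only through its first arc \<open>(a, b)\<close>, so the list \<open>[a, b]\<close>
  stands for the whole cycle in this locale.\<close>

locale arc_lifting = pair_wf_digraph D for D :: "'a pair_pre_digraph" +
  fixes a b x t :: 'a
  assumes arc: "(a, b) \<in> parcs D"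
    and x_new: "x \<notin> pverts D" and t_new: "t \<notin> pverts D" and x_neq_t: "x \<noteq> t"
begin

abbreviation lifted :: "'a pair_pre_digraph" where
  "lifted \<equiv> lifting D [a, b] x t"

lemma pverts_lifted: "pverts lifted = pverts D \<union> {x, t}"
  by (simp add: lifting_def)

lemma parcs_lifted: "parcs lifted = parcs D - {(a, b)} \<union> {(a, t), (x, b), (x, t)}"
  by (simp add: lifting_def)

lemma a_vert: "a \<in> pverts D" and b_vert: "b \<in> pverts D"
  using arc arc_fst_in_verts arc_snd_in_verts by fastforce+

lemma parcs_D_new: "(u, v) \<in> parcs D \<Longrightarrow> u \<noteq> x \<and> u \<noteq> t \<and> v \<noteq> x \<and> v \<noteq> t"
  using arc_fst_in_verts arc_snd_in_verts x_new t_new by fastforce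

lemma no_arc_from_t: "(t, v) \<notin> parcs lifted"
  using parcs_D_new a_vert t_new x_neq_t by (auto simp: parcs_lifted)

lemma arc_into_t: "(u, t) \<in> parcs lifted \<longleftrightarrow> u = a \<or> u = x"
  using parcs_D_new by (auto simp: parcs_lifted)

lemma arc_from_x: "(x, v) \<in> parcs lifted \<longleftrightarrow> v = b \<or> v = t"
  using parcs_D_new a_vert x_new by (auto simp: parcs_lifted)

lemma vpath_lifted_ends_in_t:
  assumes "vpath p (with_proj lifted)" "t \<in> set p"
  shows "last p = t"
proof -
  obtain p1 p2 where p: "p = p1 @ t # p2"
    using assms(2) split_list by metis
  have "p2 = []"
  proof (rule ccontr)
    assume "p2 \<noteq> []"
    then have "(t, hd p2) \<in> parcs lifted"
      using assms(1) vwalk_arcs_append[of "p1 @ [t]" p2]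
      by (auto simp: p vpath_with_proj_iff)
    then show False using no_arc_from_t by blast
  qed
  then show ?thesis by (simp add: p)
qed

text \<open>Away from the two new vertices, the graphs differ only in the arc \<open>(a, b)\<close>.\<close>

lemma vpath_lifted_iff:
  assumes "x \<notin> set p" "t \<notin> set p"
  shows "vpath p (with_proj lifted) \<longleftrightarrow>
           vpath p (with_proj D) \<and> (a, b) \<notin> set (vwalk_arcs p)"
proof -
  have "(u, v) \<in> parcs lifted \<longleftrightarrow> (u, v) \<in> parcs D \<and> (u, v) \<noteq> (a, b)"
    if "(u, v) \<in> set (vwalk_arcs p)" for u v
    using arcs_in_vwalk_arcs[OF that] assms by (auto simp: parcs_lifted)
  then have "set (vwalk_arcs p) \<subseteq> parcs lifted \<longleftrightarrow>
      set (vwalk_arcs p) \<subseteq> parcs D \<and> (a, b) \<notin> set (vwalk_arcs p)"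
    by (auto simp: subset_iff)
  moreover have "set p \<subseteq> pverts lifted \<longleftrightarrow> set p \<subseteq> pverts D"
    using assms by (auto simp: pverts_lifted)
  ultimately show ?thesis by (auto simp: vpath_with_proj_iff)
qed

lemma vpath_shortcut: "vpath [x, t] (with_proj lifted)"
  using x_neq_t by (simp add: vpath_with_proj_iff pverts_lifted parcs_lifted)

text \<open>A path repeats no vertex, so it uses \<open>(a, b)\<close> only once, and neither of the two parts left
  over by that arc uses it again.\<close>

lemma vpath_cut:
  assumes "vpath (p @ a # b # q) (with_proj D)"
  shows "vpath (p @ [a, t]) (with_proj lifted)" and "vpath (x # b # q) (with_proj lifted)"
proof -
  have ne: "a \<noteq> b" "b \<notin> set p" "a \<notin> set q" and V: "set (p @ a # b # q) \<subseteq> pverts D"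
    and A: "set (vwalk_arcs (p @ a # b # q)) \<subseteq> parcs D"
    using assms by (auto simp: vpath_with_proj_iff)
  have new: "x \<notin> set (p @ a # b # q)" "t \<notin> set (p @ a # b # q)"
    using V x_new t_new by blast+
  have "vpath (p @ [a]) (with_proj D)"
    using assms set_vwalk_arcs_append1[of "p @ [a]" "b # q"] by (auto simp: vpath_with_proj_iff)
  moreover have "(a, b) \<notin> set (vwalk_arcs (p @ [a]))"
    using arcs_in_vwalk_arcs[of "(a, b)" "p @ [a]"] ne by auto
  ultimately have "vpath (p @ [a]) (with_proj lifted)"
    using vpath_lifted_iff[of "p @ [a]"] new by simp
  then show "vpath (p @ [a, t]) (with_proj lifted)"
    using new set_vwalk_arcs_snoc[of "p @ [a]" t]
    by (auto simp: vpath_with_proj_iff pverts_lifted arc_into_t)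
  have "vpath (b # q) (with_proj D)"
    using assms set_vwalk_arcs_append2[of "b # q" "p @ [a]"] by (auto simp: vpath_with_proj_iff)
  moreover have "(a, b) \<notin> set (vwalk_arcs (b # q))"
    using arcs_in_vwalk_arcs[of "(a, b)" "b # q"] ne by auto
  ultimately have "vpath (b # q) (with_proj lifted)"
    using vpath_lifted_iff[of "b # q"] new by simp
  then show "vpath (x # b # q) (with_proj lifted)"
    using new by (auto simp: vpath_with_proj_iff pverts_lifted arc_from_x)
qed

text \<open>The inverse of cutting. Disjointness from a path through \<open>x\<close> keeps \<open>q\<close> from entering \<open>t\<close> by
  the shortcut \<open>x \<rightarrow> t\<close>, so it comes from \<open>a\<close>; symmetrically \<open>p\<close> leaves \<open>x\<close> towards \<open>b\<close>.\<close>

lemma vpath_glue: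
  assumes q: "vpath q (with_proj lifted)" "last q = t" "hd q \<noteq> t"
    and p: "vpath p (with_proj lifted)" "hd p = x" "last p \<noteq> x"
    and disj: "set q \<inter> set p = {}"
  shows "vpath (butlast q @ tl p) (with_proj D)"
    and "butlast q \<noteq> []" and "tl p \<noteq> []"
proof -
  obtain q0 where q0: "q = q0 @ [t]"
    using q by (metis append_butlast_last_id vpath_with_proj_iff)
  obtain p0 where p0: "p = x # p0"
    using p by (metis list.collapse vpath_with_proj_iff)
  have ne: "q0 \<noteq> []" "p0 \<noteq> []"
    using q(3) p(3) q0 p0 by auto
  then show "butlast q \<noteq> []" "tl p \<noteq> []"
    by (simp_all add: q0 p0)
  have new: "x \<notin> set q0" "t \<notin> set q0" "x \<notin> set p0" "t \<notin> set p0"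
    using disj q(1) p(1) by (auto simp: q0 p0 vpath_with_proj_iff)
  have "last q0 = a"
  proof -
    have "(last q0, t) \<in> parcs lifted"
      using q(1) ne by (auto simp: q0 vpath_with_proj_iff set_vwalk_arcs_snoc)
    moreover have "last q0 \<noteq> x" using new(1) ne(1) last_in_set by blast
    ultimately show ?thesis using arc_into_t by blast
  qed
  have "hd p0 = b"
  proof -
    have "(x, hd p0) \<in> parcs lifted"
      using p(1) ne by (auto simp: p0 vpath_with_proj_iff)
    moreover have "hd p0 \<noteq> t" using new(4) ne(2) hd_in_set by blast
    ultimately show ?thesis using arc_from_x by blast
  qed
  have "vpath q0 (with_proj lifted)" "vpath p0 (with_proj lifted)"
    using q(1) p(1) ne set_vwalk_arcs_append1[of q0 "[t]"] set_vwalk_arcs_cons[of p0 x]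
    by (auto simp: q0 p0 vpath_with_proj_iff)
  then have "vpath q0 (with_proj D)" "vpath p0 (with_proj D)"
    using new vpath_lifted_iff by blast+
  moreover have "set q0 \<inter> set p0 = {}"
    using disj by (auto simp: q0 p0)
  ultimately have "vpath (q0 @ p0) (with_proj D)"
    using ne arc \<open>last q0 = a\<close> \<open>hd p0 = b\<close>
    by (auto simp: vpath_with_proj_iff vwalk_arcs_append)
  then show "vpath (butlast q @ tl p) (with_proj D)"
    by (simp add: q0 p0)
qed

section \<open>Transferring routings\<close>

lemma routing_to_lifted:
  assumes R: "routing D X Y R"
  shows "\<exists>R'. routing lifted (X \<union> {x}) (Y \<union> {t}) R'"
proof -
  have new: "x \<notin> set p" "t \<notin> set p" if "p \<in> R" for p
    using routingD(1)[OF R that] x_new t_new by (auto simp: vpath_with_proj_iff)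
  show ?thesis
  proof (cases "\<exists>r\<in>R. (a, b) \<in> set (vwalk_arcs r)")
    case False
    have "routing lifted (X \<union> {x}) (Y \<union> {t}) (insert [x, t] R)"
    proof (rule routingI)
      fix p assume "p \<in> insert [x, t] R"
      then show "vpath p (with_proj lifted)"
        using vpath_shortcut vpath_lifted_iff[OF new] routingD(1)[OF R] False by blast
    next
      fix p q assume "p \<in> insert [x, t] R" "q \<in> insert [x, t] R" "p \<noteq> q"
      then show "set p \<inter> set q = {}"
        using routingD(2)[OF R] new by auto
    qed (use routingD(3,4)[OF R] in auto)
    then show ?thesis by blast
  next
    case True
    then obtain p0 q0 where r: "p0 @ a # b # q0 \<in> R" (is "?r \<in> R")
      by (auto simp: in_vwalk_arcs_iff)
    define S where "S = R - {?r}"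
    have S_R: "S \<subseteq> R" and R_S: "R = insert ?r S"
      using r by (auto simp: S_def)
    have S_disj: "set p \<inter> set ?r = {}" if "p \<in> S" for p
      using that routingD(2)[OF R _ r] unfolding S_def by blast
    \<comment> \<open>The tail \<open>a\<close> of the removed arc is occupied by the path that is cut.\<close>
    have S_arc: "(a, b) \<notin> set (vwalk_arcs p)" if "p \<in> S" for p
      using S_disj[OF that] arcs_in_vwalk_arcs[of "(a, b)" p] by auto
    let ?p = "p0 @ [a, t]" and ?q = "x # b # q0"
    have pq: "set ?p \<inter> set ?q = {}"
      using new[OF r] routingD(1)[OF R r] x_neq_t by (auto simp: vpath_with_proj_iff)
    have Spq: "set p \<inter> set ?p = {}" "set p \<inter> set ?q = {}" if "p \<in> S" for p
      using S_disj[OF that] new[of p] S_R that by auto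
    have "routing lifted (X \<union> {x}) (Y \<union> {t}) (insert ?p (insert ?q S))"
    proof (rule routingI)
      fix p assume "p \<in> insert ?p (insert ?q S)"
      then show "vpath p (with_proj lifted)"
        using vpath_cut[OF routingD(1)[OF R r]] vpath_lifted_iff[OF new] routingD(1)[OF R]
          S_R S_arc by blast
    next
      fix p q assume "p \<in> insert ?p (insert ?q S)" "q \<in> insert ?p (insert ?q S)" "p \<noteq> q"
      then show "set p \<inter> set q = {}"
        using pq Spq routingD(2)[OF R] S_R by (metis Int_commute insertE subsetD)
    next
      have "hd ?p = hd ?r" by (simp add: hd_append)
      then show "hd ` insert ?p (insert ?q S) = X \<union> {x}"
        using routingD(3)[OF R] by (auto simp: R_S)
    next
      have "last ?q = last ?r" by simp
      then have "last ?q \<in> Y" using routingD(4)[OF R r] by metis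
      then show "last p \<in> Y \<union> {t}" if "p \<in> insert ?p (insert ?q S)" for p
        using that routingD(4)[OF R] S_R by auto
    qed
    then show ?thesis by blast
  qed
qed

lemma routing_from_lifted:
  assumes R: "routing lifted (X \<union> {x}) (Y \<union> {t}) R"
    and X: "X \<subseteq> pverts D" and Y: "Y \<subseteq> pverts D"
  shows "\<exists>R'. routing D X Y R'"
proof -
  obtain p where p: "p \<in> R" "hd p = x"
    using routingD(3)[OF R] by (metis UnI2 image_iff insertI1)
  have vp: "vpath p (with_proj lifted)" by (rule routingD(1)[OF R p(1)])
  have x_p: "x \<in> set p"
    using vp p(2) hd_in_set vpath_with_proj_iff by metis
  have lp: "last p \<noteq> x"
    using routingD(4)[OF R p(1)] Y x_new x_neq_t by auto
  have x_other: "x \<notin> set r" if "r \<in> R" "r \<noteq> p" for r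
    using routingD(2)[OF R that(1) p(1) that(2)] x_p by blast
  have hd_other: "hd r \<in> X" if "r \<in> R" "r \<noteq> p" for r
  proof -
    have "hd r \<in> set r"
      using routingD(1)[OF R that(1)] by (simp add: vpath_with_proj_iff)
    then have "hd r \<noteq> x" using x_other[OF that] by metis
    then show ?thesis using routingD(3)[OF R] that(1) by blast
  qed
  \<comment> \<open>Such a path misses \<open>x\<close> because \<open>p\<close> occupies it, and misses \<open>t\<close> because no arc leaves \<open>t\<close>.\<close>
  have keep: "vpath r (with_proj D)" "last r \<in> Y" if "r \<in> R" "r \<noteq> p" "last r \<noteq> t" for r
    using vpath_lifted_iff[of r] x_other[OF that(1,2)] routingD(1,4)[OF R that(1)] that(3)
      vpath_lifted_ends_in_t[of r] by auto
  show ?thesis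
  proof (cases "\<exists>q\<in>R. q \<noteq> p \<and> last q = t")
    case False
    have "hd ` (R - {p}) = X"
    proof
      show "hd ` (R - {p}) \<subseteq> X" using hd_other by blast
      show "X \<subseteq> hd ` (R - {p})"
        using routingD(3)[OF R] p(2) X x_new by blast
    qed
    then have "routing D X Y (R - {p})"
      using keep False routingD(2)[OF R] by (intro routingI) auto
    then show ?thesis by blast
  next
    case True
    then obtain q where q: "q \<in> R" "q \<noteq> p" "last q = t" by blast
    have vq: "vpath q (with_proj lifted)" by (rule routingD(1)[OF R q(1)])
    have hq: "hd q \<noteq> t" using hd_other[OF q(1,2)] X t_new by blast
    have disj: "set q \<inter> set p = {}" by (rule routingD(2)[OF R q(1) p(1) q(2)])
    note glue = vpath_glue[OF vq q(3) hq vp p(2) lp disj]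
    let ?r = "butlast q @ tl p" and ?S = "R - {p, q}"
    have t_q: "t \<in> set q"
      using vq q(3) last_in_set vpath_with_proj_iff by metis
    have S_t: "last r \<noteq> t" if "r \<in> ?S" for r
    proof -
      have "t \<notin> set r" using routingD(2)[OF R _ q(1), of r] that t_q by blast
      then show ?thesis
        using routingD(1)[OF R, of r] that last_in_set vpath_with_proj_iff by blast
    qed
    have hr: "hd ?r = hd q"
    proof -
      have "hd ?r = hd (butlast q)" using glue(2) by simp
      also have "\<dots> = hd q" using glue(2) by (metis append_butlast_last_id butlast.simps(1) hd_append2)
      finally show ?thesis .
    qed
    have lr: "last ?r \<in> Y"
    proof -
      have "last p \<noteq> t"
        using disj t_q vp last_in_set vpath_with_proj_iff by (metis disjoint_iff)
      then have "last p \<in> Y" using routingD(4)[OF R p(1)] by blast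
      then show ?thesis using glue(3) by (simp add: last_tl)
    qed
    have r_sub: "set ?r \<subseteq> set q \<union> set p"
      by (auto dest: in_set_butlastD list.set_sel(2)) (metis list.set_sel(2) tl_Nil)
    have S_r: "set s \<inter> set ?r = {}" if "s \<in> ?S" for s
      using r_sub routingD(2)[OF R, of s p] routingD(2)[OF R, of s q] that p(1) q(1) by blast
    have "routing D X Y (insert ?r ?S)"
    proof (rule routingI)
      fix s assume "s \<in> insert ?r ?S"
      then show "vpath s (with_proj D)" "last s \<in> Y"
        using glue(1) keep S_t lr by blast+
    next
      fix s s' assume "s \<in> insert ?r ?S" "s' \<in> insert ?r ?S" "s \<noteq> s'"
      then show "set s \<inter> set s' = {}"
        using S_r routingD(2)[OF R] by (metis Diff_iff Int_commute insertE)
    next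
      show "hd ` insert ?r ?S = X"
      proof
        show "hd ` insert ?r ?S \<subseteq> X"
          using hr hd_other q by auto
        show "X \<subseteq> hd ` insert ?r ?S"
        proof
          fix y assume y: "y \<in> X"
          then have "y \<in> hd ` R"
            using routingD(3)[OF R] by simp
          then obtain s where s: "s \<in> R" "hd s = y" by auto
          have "s \<noteq> p" using s(2) y p(2) X x_new by blast
          show "y \<in> hd ` insert ?r ?S"
          proof (cases "s = q")
            case True
            then have "y = hd ?r" using hr s(2) by simp
            then show ?thesis by blast
          next
            case False
            then have "s \<in> ?S" using s(1) \<open>s \<noteq> p\<close> by blast
            then show ?thesis using s(2) by blast
          qed
        qed
      qed
    qed
    then show ?thesis by blast
  qed
qed

end

section \<open>The contraction\<close>

text \<open>An independent set is its own only basis, so no choice of a basis remains in the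
  contraction.\<close>

lemma contract_independent_singleton:
  assumes "x \<notin> E" "ground N = E \<union> {x}" "{x} \<in> indeps N"
  shows "contract_to N E = \<lparr>ground = E, indeps = {X. X \<subseteq> E \<and> X \<union> {x} \<in> indeps N}\<rparr>"
proof -
  have "basis_of N {x} B \<longleftrightarrow> B = {x}" for B
  proof
    assume "basis_of N {x} B"
    then have "{x} = B"
      using assms(3) unfolding basis_of_def by (metis order.refl)
    then show "B = {x}" by simp
  qed (use assms(3) in \<open>auto simp: basis_of_def\<close>)
  moreover have "ground N - E = {x}" "ground N \<inter> {x} = {x}" "ground N - {x} = E"
    using assms(1,2) by auto
  ultimately show ?thesis
    by (simp add: contract_to_def contract_def)
qed

theorem lemma3p4:
  fixes D :: "'a pair_pre_digraph" and E T :: "'a set" and c :: "'a list" and x t :: 'a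
  assumes "pair_fin_digraph D"
    and "E \<subseteq> pverts D" and "T \<subseteq> pverts D"
    and "vcycle c D"
    and "x \<notin> pverts D" and "t \<notin> pverts D" and "x \<noteq> t"
  shows "gammoid D T E = contract_to (gammoid (lifting D c x t) (T \<union> {t}) (E \<union> {x})) E"
proof -
  obtain a b c' where c: "c = a # b # c'"
    using assms(4) unfolding vcycle_def by (cases c rule: vwalk_arcs.cases) auto
  have ab: "(a, b) \<in> parcs D"
    using assms(4) by (auto simp: vcycle_def vwalk_def c)
  interpret pair_fin_digraph D by (rule assms(1))
  interpret arc_lifting D a b x t
    by unfold_locales (use ab assms in auto)
  let ?N = "gammoid lifted (T \<union> {t}) (E \<union> {x})"
  have "lifting D c x t = lifted"
    by (simp add: lifting_def c)
  moreover have "contract_to ?N E = \<lparr>ground = E, indeps = {X. X \<subseteq> E \<and> X \<union> {x} \<in> indeps ?N}\<rparr>"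
  proof (rule contract_independent_singleton)
    have "routing lifted {x} (T \<union> {t}) {[x, t]}"
      using vpath_shortcut by (simp add: routing_def)
    then show "{x} \<in> indeps ?N"
      by (auto simp: gammoid_def)
  qed (use assms in \<open>auto simp: gammoid_def\<close>)
  moreover have "X \<union> {x} \<in> indeps ?N \<longleftrightarrow> (\<exists>R. routing D X T R)" if "X \<subseteq> E" for X
  proof -
    have "X \<subseteq> pverts D" using that assms(2) by simp
    then have "(\<exists>R. routing lifted (X \<union> {x}) (T \<union> {t}) R) \<longleftrightarrow> (\<exists>R. routing D X T R)"
      using routing_to_lifted[of X T] routing_from_lifted[of X T, OF _ _ assms(3)] by metis
    moreover have "X \<union> {x} \<subseteq> E \<union> {x}" using that by auto
    ultimately show ?thesis by (simp add: gammoid_def)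
  qed
  ultimately show ?thesis
    by (simp add: gammoid_def cong: conj_cong)
qed

end
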